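(* Let $\Sigma=(\Gamma,\sigma)$ be a signed graph with underlying graph $\Gamma=(V,E)$ and let $e\in E$ be an edge with $\sigma(e)=+1$. Then, writing $T_\Sigma=T_\Sigma(X,Y,Z)$: (i) if $e$ is an ordinary edge of $\Gamma$, then $T_\Sigma=T_{\Sigma/e}+T_{\Sigma\backslash e}$; (ii) if $e$ is a bridge of $\Gamma$ and a circuit path edge of $\Sigma$, then $T_\Sigma=T_{\Sigma/e}+(X-1)T_{\Sigma\backslash e}$; (iii) if $e$ is a bridge of $\Gamma$ that is not a circuit path edge of $\Sigma$, then $T_\Sigma=XT_{\Sigma/e}$; (iv) if $e$ is a loop of $\Gamma$ (positive in $\Sigma$), then $T_\Sigma=YT_{\Sigma\backslash e}$. Moreover, if $\Sigma$ consists of a single vertex with $\ell\ge1$ negative loops then $T_\Sigma=1+(Z-1)[1+Y+\cdots+Y^{\ell-1}]$, and $T_\Sigma=1$ if $\Sigma$ is a single vertex with no edges.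
   Context: A signed graph $\Sigma=(\Gamma,\sigma)$: finite graph $\Gamma=(V,E)$ (loops, multiple edges allowed), $\sigma:E\to\{-1,1\}$. A cycle (loops included) is balanced if the product of its edge signs is $1$, unbalanced otherwise. For $A\subseteq E$, $\Sigma\backslash A^c$ is the spanning signed subgraph $(V,A)$ with restricted signature. $k,k_b,k_u$: numbers of connected components, balanced components (all cycles balanced), unbalanced components. Signed Tutte polynomial: $$T_\Sigma(X,Y,Z)=\sum_{A\subseteq E}(X-1)^{k(\Sigma\backslash A^c)-k(\Sigma)}(Y-1)^{|A|-|V|+k_b(\Sigma\backslash A^c)}(Z-1)^{k_u(\Sigma\backslash A^c)}.$$ A bridge of $\Gamma$ is a non-loop edge whose deletion increases the number of components; an ordinary edge of $\Gamma$ is one that is neither a loop nor a bridge. An unbalanced loose handcuff in $\Sigma$ consists of two vertex-disjoint unbalanced cycles joined by a path meeting the cycles only at its endpoints; an edge is a circuit path edge of $\Sigma$ if it is an edge of such a path for some unbalanced loose handcuff. $\Sigma\backslash e$ deletes $e$ (restricting $\sigma$). For a positive non-loop edge $e$, $\Sigma/e$ is obtained by contracting $e$ in $\Gamma$ and keeping the signs of the remaining edges; for a positive loop $e$, $\Sigma/e=\Sigma\backslash e$. *)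

theory Defs
  imports Main
begin

text \<open>
  Edges have their own type, so multiple edges are allowed; the endpoints of an edge form a set
  of one vertex (a loop) or of two vertices.
\<close>

record ('v, 'e) sgraph =
  verts :: "'v set"
  edges :: "'e set"
  ends :: "'e \<Rightarrow> 'v set"
  sign :: "'e \<Rightarrow> int"

definition signed_graph :: "('v, 'e) sgraph \<Rightarrow> bool" where
  "signed_graph G \<longleftrightarrow>
     finite (verts G) \<and> finite (edges G) \<and>
     (\<forall>f\<in>edges G. \<exists>u\<in>verts G. \<exists>v\<in>verts G. ends G f = {u, v}) \<and>
     (\<forall>f\<in>edges G. sign G f \<in> {-1, 1})"

definition spanning :: "('v, 'e) sgraph \<Rightarrow> 'e set \<Rightarrow> ('v, 'e) sgraph" where
  "spanning G A = G\<lparr>edges := A\<rparr>"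

definition delete :: "('v, 'e) sgraph \<Rightarrow> 'e \<Rightarrow> ('v, 'e) sgraph" where
  "delete G e = spanning G (edges G - {e})"

text \<open>
  The vertices of the contraction are blocks of vertices of the original graph: the ends of the
  contracted edge form one block and every other vertex is a singleton block. Signs are kept, so
  this is the contraction of signed graphs for positive edges only (a negative non-loop edge would
  have to be made positive by switching first). For a loop the construction is deletion, up to
  renaming each vertex \<open>x\<close> to \<open>{x}\<close>.
\<close>

definition contract_vertex :: "('v, 'e) sgraph \<Rightarrow> 'e \<Rightarrow> 'v \<Rightarrow> 'v set" where
  "contract_vertex G e x = (if x \<in> ends G e then ends G e else {x})"

definition contract :: "('v, 'e) sgraph \<Rightarrow> 'e \<Rightarrow> ('v set, 'e) sgraph" where
  "contract G e =
     \<lparr>verts = contract_vertex G e ` verts G,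
      edges = edges G - {e},
      ends = (\<lambda>f. contract_vertex G e ` ends G f),
      sign = sign G\<rparr>"

definition adj :: "('v, 'e) sgraph \<Rightarrow> ('v \<times> 'v) set" where
  "adj G = {(u, v). \<exists>f\<in>edges G. ends G f = {u, v}}"

definition connected_rel :: "('v, 'e) sgraph \<Rightarrow> ('v \<times> 'v) set" where
  "connected_rel G = {(u, v). u \<in> verts G \<and> v \<in> verts G \<and> (u, v) \<in> (adj G)\<^sup>*}"

definition components :: "('v, 'e) sgraph \<Rightarrow> 'v set set" where
  "components G = verts G // connected_rel G"

text \<open>
  A cycle is given by its vertices and edges in cyclic order; length 1 is a loop and length 2 is a
  pair of distinct parallel edges.
\<close>

definition is_cycle :: "('v, 'e) sgraph \<Rightarrow> 'v list \<Rightarrow> 'e list \<Rightarrow> bool" where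
  "is_cycle G vs es \<longleftrightarrow>
     vs \<noteq> [] \<and> length es = length vs \<and> distinct vs \<and> distinct es \<and>
     set vs \<subseteq> verts G \<and> set es \<subseteq> edges G \<and>
     (\<forall>i<length vs. ends G (es ! i) = {vs ! i, vs ! (Suc i mod length vs)})"

definition is_path :: "('v, 'e) sgraph \<Rightarrow> 'v list \<Rightarrow> 'e list \<Rightarrow> bool" where
  "is_path G vs es \<longleftrightarrow>
     length vs = Suc (length es) \<and> distinct vs \<and>
     set vs \<subseteq> verts G \<and> set es \<subseteq> edges G \<and>
     (\<forall>i<length es. ends G (es ! i) = {vs ! i, vs ! Suc i})"

definition sign_product :: "('v, 'e) sgraph \<Rightarrow> 'e list \<Rightarrow> int" where
  "sign_product G es = prod_list (map (sign G) es)"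

definition balanced_cycle :: "('v, 'e) sgraph \<Rightarrow> 'v list \<Rightarrow> 'e list \<Rightarrow> bool" where
  "balanced_cycle G vs es \<longleftrightarrow> is_cycle G vs es \<and> sign_product G es = 1"

definition unbalanced_cycle :: "('v, 'e) sgraph \<Rightarrow> 'v list \<Rightarrow> 'e list \<Rightarrow> bool" where
  "unbalanced_cycle G vs es \<longleftrightarrow> is_cycle G vs es \<and> sign_product G es \<noteq> 1"

definition balanced_component :: "('v, 'e) sgraph \<Rightarrow> 'v set \<Rightarrow> bool" where
  "balanced_component G C \<longleftrightarrow>
     (\<forall>vs es. is_cycle G vs es \<and> set vs \<subseteq> C \<longrightarrow> balanced_cycle G vs es)"

definition num_comp :: "('v, 'e) sgraph \<Rightarrow> nat" where
  "num_comp G = card (components G)"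

definition num_bal :: "('v, 'e) sgraph \<Rightarrow> nat" where
  "num_bal G = card {C \<in> components G. balanced_component G C}"

definition num_unbal :: "('v, 'e) sgraph \<Rightarrow> nat" where
  "num_unbal G = card {C \<in> components G. \<not> balanced_component G C}"

text \<open>
  The polynomial is rendered by its value at arbitrary elements of an arbitrary commutative ring;
  taking the ring of integer polynomials in three variables and its indeterminates gives the formal
  polynomial. For a signed graph and \<open>A \<subseteq> edges G\<close> both differences in the exponents are
  nonnegative, so subtraction on natural numbers is exact: removing edges does not decrease the
  number of components, and \<open>card (verts G) - num_bal (spanning G A)\<close> is the rank of \<open>A\<close> in the
  frame matroid of the signed graph, hence at most \<open>card A\<close>.
\<close>

definition signed_tutte ::
    "('v, 'e) sgraph \<Rightarrow> 'a::comm_ring_1 \<Rightarrow> 'a \<Rightarrow> 'a \<Rightarrow> 'a" where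
  "signed_tutte G X Y Z =
     (\<Sum>A\<in>Pow (edges G).
        (X - 1) ^ (num_comp (spanning G A) - num_comp G) *
        (Y - 1) ^ (card A + num_bal (spanning G A) - card (verts G)) *
        (Z - 1) ^ num_unbal (spanning G A))"

definition is_loop :: "('v, 'e) sgraph \<Rightarrow> 'e \<Rightarrow> bool" where
  "is_loop G e \<longleftrightarrow> e \<in> edges G \<and> (\<exists>v. ends G e = {v})"

definition is_bridge :: "('v, 'e) sgraph \<Rightarrow> 'e \<Rightarrow> bool" where
  "is_bridge G e \<longleftrightarrow>
     e \<in> edges G \<and> \<not> is_loop G e \<and> num_comp G < num_comp (delete G e)"

definition is_ordinary :: "('v, 'e) sgraph \<Rightarrow> 'e \<Rightarrow> bool" where
  "is_ordinary G e \<longleftrightarrow> e \<in> edges G \<and> \<not> is_loop G e \<and> \<not> is_bridge G e"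

definition loose_handcuff ::
    "('v, 'e) sgraph \<Rightarrow> 'v list \<Rightarrow> 'e list \<Rightarrow> 'v list \<Rightarrow> 'e list \<Rightarrow> 'v list \<Rightarrow> 'e list \<Rightarrow> bool" where
  "loose_handcuff G vs1 es1 vs2 es2 ps qs \<longleftrightarrow>
     unbalanced_cycle G vs1 es1 \<and> unbalanced_cycle G vs2 es2 \<and>
     set vs1 \<inter> set vs2 = {} \<and>
     is_path G ps qs \<and>
     set ps \<inter> set vs1 = {hd ps} \<and> set ps \<inter> set vs2 = {last ps}"

definition circuit_path_edge :: "('v, 'e) sgraph \<Rightarrow> 'e \<Rightarrow> bool" where
  "circuit_path_edge G e \<longleftrightarrow>
     (\<exists>vs1 es1 vs2 es2 ps qs. loose_handcuff G vs1 es1 vs2 es2 ps qs \<and> e \<in> set qs)"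

end

theory Submission
  imports Defs
begin

text \<open>
  A component is balanced iff it carries a potential (a switching function): a labelling of its
  vertices by signs such that every edge has the product of the labels of its ends as its sign.
  Potentials are transported directly along contraction of a positive edge, and along joining two
  components by an edge, so all components and their balance are preserved by contraction; the
  subsets containing \<open>e\<close> thus contribute \<open>T(\<Sigma>/e)\<close>. The subsets avoiding \<open>e\<close> contribute
  \<open>T(\<Sigma>\e)\<close>, times \<open>X - 1\<close> for a bridge. If a bridge \<open>e\<close> joins two unbalanced components of some
  \<open>(V, A)\<close>, a shortest path between their unbalanced cycles runs through \<open>e\<close> and completes a loose
  handcuff; otherwise at least one of the two is balanced, adding \<open>e\<close> loses exactly one balanced
  component, and \<open>T(\<Sigma>\e) = T(\<Sigma>/e)\<close>.
\<close>

section \<open>Reachability classes as components\<close>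

definition comp_of :: "('v, 'e) sgraph \<Rightarrow> 'v \<Rightarrow> 'v set" where
  "comp_of G x = {y \<in> verts G. (x, y) \<in> (adj G)\<^sup>*}"

text \<open>The edge condition ranges over both orders of the ends, and over loops, where it reads
  \<open>sign G f = p a * p a\<close>, so that a loop at a vertex of \<open>C\<close> must be
  positive. Labels are signs everywhere, also outside \<open>C\<close>, so squares of labels are 1
  without any membership condition.\<close>

definition potential :: "('v, 'e) sgraph \<Rightarrow> 'v set \<Rightarrow> ('v \<Rightarrow> int) \<Rightarrow> bool" where
  "potential G C p \<longleftrightarrow> (\<forall>x. p x \<in> {-1, 1}) \<and>
     (\<forall>f\<in>edges G. \<forall>a b. ends G f = {a, b} \<and> a \<in> C \<longrightarrow> sign G f = p a * p b)"

lemma signed_graph_ends: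
  assumes "signed_graph G" "f \<in> edges G"
  obtains u v where "u \<in> verts G" "v \<in> verts G" "ends G f = {u, v}"
  using assms unfolding signed_graph_def by blast

lemma adj_in_verts: "signed_graph G \<Longrightarrow> (x, y) \<in> adj G \<Longrightarrow> x \<in> verts G \<and> y \<in> verts G"
  unfolding signed_graph_def adj_def by (fastforce simp: doubleton_eq_iff)

lemma sym_adj: "sym (adj G)"
  by (auto simp: sym_def adj_def insert_commute)

lemma reach_sym: "(x, y) \<in> (adj G)\<^sup>* \<Longrightarrow> (y, x) \<in> (adj G)\<^sup>*"
  by (rule symD[OF sym_rtrancl[OF sym_adj]])

lemma reach_trans: "(x, y) \<in> (adj G)\<^sup>* \<Longrightarrow> (y, z) \<in> (adj G)\<^sup>* \<Longrightarrow> (x, z) \<in> (adj G)\<^sup>*"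
  by (rule rtrancl_trans)

lemma reach_edge: "f \<in> edges G \<Longrightarrow> ends G f = {u, v} \<Longrightarrow> (u, v) \<in> (adj G)\<^sup>*"
  by (rule r_into_rtrancl) (auto simp: adj_def)

lemma components_eq: "components G = comp_of G ` verts G"
  by (auto simp: components_def quotient_def connected_rel_def comp_of_def)

lemma finite_components: "signed_graph G \<Longrightarrow> finite (components G)"
  by (simp add: components_eq signed_graph_def)

lemma comp_of_self: "x \<in> verts G \<Longrightarrow> x \<in> comp_of G x"
  by (simp add: comp_of_def)

lemma comp_of_in_components: "x \<in> verts G \<Longrightarrow> comp_of G x \<in> components G"
  by (simp add: components_eq)

lemma comp_of_cong: "(x, y) \<in> (adj G)\<^sup>* \<Longrightarrow> comp_of G x = comp_of G y"
  unfolding comp_of_def by (blast intro: reach_trans reach_sym)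

lemma comp_of_eq_iff:
  "y \<in> verts G \<Longrightarrow> comp_of G x = comp_of G y \<longleftrightarrow> (x, y) \<in> (adj G)\<^sup>*"
  using comp_of_cong[of x y G] comp_of_self[of y G] by (auto simp: comp_of_def)

lemma component_of_mem:
  assumes "C \<in> components G" "x \<in> C"
  shows "C = comp_of G x"
proof -
  obtain z where z: "C = comp_of G z" using assms(1) by (auto simp: components_eq)
  then have "(z, x) \<in> (adj G)\<^sup>*" using assms(2) by (simp add: comp_of_def)
  then show ?thesis unfolding z by (rule comp_of_cong)
qed

lemma component_nonempty: "C \<in> components G \<Longrightarrow> C \<noteq> {}"
  using comp_of_self by (fastforce simp: components_eq)

lemma component_closed:
  assumes "signed_graph G" "C \<in> components G" "f \<in> edges G" "ends G f = {a, b}" "a \<in> C"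
  shows "b \<in> C"
proof -
  have "(a, b) \<in> adj G" using assms by (auto simp: adj_def)
  then show ?thesis
    using component_of_mem[OF assms(2,5)] adj_in_verts[OF assms(1)] by (auto simp: comp_of_def)
qed

lemma delete_sel [simp]:
  "verts (delete G e) = verts G" "edges (delete G e) = edges G - {e}"
  "ends (delete G e) = ends G" "sign (delete G e) = sign G"
  by (simp_all add: delete_def spanning_def)

lemma spanning_sel [simp]:
  "verts (spanning G A) = verts G" "edges (spanning G A) = A"
  "ends (spanning G A) = ends G" "sign (spanning G A) = sign G"
  by (simp_all add: spanning_def)

lemma spanning_spanning [simp]: "spanning (spanning G A) B = spanning G B"
  by (simp add: spanning_def)

lemma spanning_edges [simp]: "spanning G (edges G) = G"
  by (simp add: spanning_def)

lemma spanning_delete [simp]: "spanning (delete G e) A = spanning G A"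
  by (simp add: delete_def)

lemma delete_spanning: "delete (spanning G A) e = spanning G (A - {e})"
  by (simp add: delete_def)

lemma signed_graph_spanning: "signed_graph G \<Longrightarrow> A \<subseteq> edges G \<Longrightarrow> signed_graph (spanning G A)"
  unfolding signed_graph_def by (auto intro: finite_subset)

lemma signed_graph_delete: "signed_graph G \<Longrightarrow> signed_graph (delete G e)"
  unfolding delete_def by (rule signed_graph_spanning) auto

subsection \<open>Components after deleting an edge\<close>

text \<open>Two opposite crossings of \<open>e\<close> in a row cancel, and between two crossings in
  the same direction the walk returns along edges other than \<open>e\<close>. So at most one
  crossing has to be recorded, together with its direction, and these three alternatives are
  preserved when an edge is appended to the walk.\<close>

lemma reach_delete:
  assumes "e \<in> edges G" "ends G e = {u, v}"
  defines "R \<equiv> (adj (delete G e))\<^sup>*"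
  shows "(x, y) \<in> (adj G)\<^sup>* \<longleftrightarrow>
    (x, y) \<in> R \<or> (x, u) \<in> R \<and> (v, y) \<in> R \<or> (x, v) \<in> R \<and> (u, y) \<in> R"
    (is "?L \<longleftrightarrow> ?P y")
proof
  assume ?L
  then show "?P y"
  proof (induction rule: rtrancl_induct)
    case base
    then show ?case by (simp add: R_def)
  next
    case (step y z)
    have tr: "\<And>a b c. (a, b) \<in> R \<Longrightarrow> (b, c) \<in> R \<Longrightarrow> (a, c) \<in> R"
      unfolding R_def by (rule reach_trans)
    have sy: "\<And>a b. (a, b) \<in> R \<Longrightarrow> (b, a) \<in> R"
      unfolding R_def by (rule reach_sym)
    have rf: "\<And>a. (a, a) \<in> R" by (simp add: R_def)
    obtain f where f: "f \<in> edges G" "ends G f = {y, z}"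
      using step.hyps by (auto simp: adj_def)
    show ?case
    proof (cases "f = e")
      case True
      then have "y = u \<and> z = v \<or> y = v \<and> z = u"
        using f assms by (auto simp: doubleton_eq_iff)
      then show ?thesis using step.IH rf tr sy by blast
    next
      case False
      then have "(y, z) \<in> R"
        unfolding R_def using f by (intro reach_edge[of f]) auto
      then show ?thesis using step.IH tr by blast
    qed
  qed
next
  have "R \<subseteq> (adj G)\<^sup>*"
    unfolding R_def by (rule rtrancl_mono) (auto simp: adj_def)
  moreover have "(u, v) \<in> (adj G)\<^sup>*"
    using reach_edge assms by metis
  ultimately show "?P y \<Longrightarrow> ?L"
    by (meson reach_sym reach_trans subsetD)
qed

lemma comp_of_delete:
  assumes "e \<in> edges G" "ends G e = {u, v}" "u \<in> verts G" "v \<in> verts G" "x \<in> verts G"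
  defines "H \<equiv> delete G e"
  shows "comp_of G x =
    (if x \<in> comp_of H u \<union> comp_of H v then comp_of H u \<union> comp_of H v else comp_of H x)"
proof -
  have v: "verts H = verts G" by (simp add: H_def)
  show ?thesis
    unfolding comp_of_def reach_delete[OF assms(1,2)] H_def[symmetric] v
    using assms(3-5) by (auto intro: reach_sym reach_trans)
qed

text \<open>One formula serves both cases: if the ends of \<open>e\<close> stay connected, the union
  is the component that was just removed, so nothing changes; otherwise two components are fused
  into one.\<close>

lemma components_delete:
  assumes "e \<in> edges G" "ends G e = {u, v}" "u \<in> verts G" "v \<in> verts G"
  defines "H \<equiv> delete G e"
  shows "components G =
    insert (comp_of H u \<union> comp_of H v) (components H - {comp_of H u, comp_of H v})"
    (is "_ = insert ?U ?D")
proof -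
  have v: "verts H = verts G" by (simp add: H_def)
  have in_U: "x \<in> ?U \<longleftrightarrow> comp_of H x = comp_of H u \<or> comp_of H x = comp_of H v"
    if "x \<in> verts G" for x
    using that assms(3,4) v comp_of_eq_iff[of u H x] comp_of_eq_iff[of v H x]
    by (auto simp: comp_of_def intro: reach_sym)
  have c: "comp_of G x = (if x \<in> ?U then ?U else comp_of H x)" if "x \<in> verts G" for x
    using comp_of_delete[OF assms(1-4) that] by (simp add: H_def)
  show ?thesis
  proof (intro set_eqI iffI)
    fix C assume "C \<in> components G"
    then obtain x where x: "x \<in> verts G" "C = comp_of G x" by (auto simp: components_eq)
    show "C \<in> insert ?U ?D"
    proof (cases "x \<in> ?U")
      case False
      then have "C = comp_of H x" "C \<noteq> comp_of H u" "C \<noteq> comp_of H v"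
        using x c[OF x(1)] in_U[OF x(1)] by auto
      then show ?thesis using x v comp_of_in_components[of x H] by simp
    qed (use x c in simp)
  next
    fix C assume C: "C \<in> insert ?U ?D"
    show "C \<in> components G"
    proof (cases "C = ?U")
      case True
      moreover have "comp_of G u = ?U"
        using c[OF assms(3)] in_U[OF assms(3)] by simp
      ultimately show ?thesis using comp_of_in_components[OF assms(3)] by simp
    next
      case False
      then obtain x where x: "x \<in> verts G" "C = comp_of H x" "x \<notin> ?U"
        using C in_U v by (auto simp: components_eq)
      then have "C = comp_of G x" using c by simp
      then show ?thesis using x comp_of_in_components by metis
    qed
  qed
qed

text \<open>The only component of \<open>H\<close> containing \<open>u\<close> is
  \<open>comp_of H u\<close>. This makes the insertion in \<open>components_delete\<close> add a
  genuinely new element, so that cardinalities can be counted.\<close>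

lemma union_notin_other_components:
  assumes "u \<in> verts H"
  shows "comp_of H u \<union> B \<notin> components H - {comp_of H u, C}"
  using component_of_mem[of "comp_of H u \<union> B" H u] comp_of_self[OF assms] by auto

subsection \<open>Balance and potentials\<close>

text \<open>Each vertex of a cycle is an end of two consecutive edges (for a loop, twice an end of
  one), so every label enters the sign product twice and the product is the square of a product of
  signs.\<close>

lemma potential_imp_balanced:
  assumes "potential G C p"
  shows "balanced_component G C"
  unfolding balanced_component_def balanced_cycle_def
proof (intro allI impI conjI; (elim conjE)?)
  fix vs es assume cyc: "is_cycle G vs es" and sub: "set vs \<subseteq> C"
  have len: "length es = length vs" using cyc by (simp add: is_cycle_def)
  have "p x \<in> {-1, 1}" for x using assms by (simp add: potential_def)
  then have sq: "p x * p x = 1" for x by (metis insertE minus_mult_minus mult_1 singletonD)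
  \<comment> \<open>The first ends of the edges, read around the cycle, form \<open>vs\<close>, and
    the second ends form \<open>vs\<close> rotated by one; both lists have the same product of
    labels.\<close>
  have "map (sign G) es = map (\<lambda>(x, y). p x * p y) (zip vs (rotate1 vs))"
  proof (rule nth_equalityI)
    fix i assume i: "i < length (map (sign G) es)"
    then have "ends G (es ! i) = {vs ! i, vs ! (Suc i mod length vs)}" "es ! i \<in> edges G"
        "vs ! i \<in> C"
      using cyc sub len by (auto simp: is_cycle_def)
    then have "sign G (es ! i) = p (vs ! i) * p (vs ! (Suc i mod length vs))"
      using assms by (auto simp: potential_def)
    then show "map (sign G) es ! i = map (\<lambda>(x, y). p x * p y) (zip vs (rotate1 vs)) ! i"
      using i len by (simp add: nth_rotate1)
  qed (simp add: len)
  moreover have "prod_list (map (\<lambda>(x, y). p x * p y) (zip xs ys)) =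
      prod_list (map p xs) * prod_list (map p ys)" if "length xs = length ys" for xs ys
    using that by (induction xs ys rule: list_induct2) auto
  moreover have "prod_list (map p (rotate1 vs)) = prod_list (map p vs)"
    by (cases vs) (auto simp: mult.commute)
  moreover have "prod_list (map p xs) * prod_list (map p xs) = 1" for xs
  proof (induction xs)
    case (Cons x xs)
    have "prod_list (map p (x # xs)) * prod_list (map p (x # xs)) =
        (p x * p x) * (prod_list (map p xs) * prod_list (map p xs))"
      by (simp add: ac_simps)
    then show ?case using Cons sq by simp
  qed simp
  ultimately show "sign_product G es = 1"
    by (simp add: sign_product_def)
qed

section \<open>Paths, their signs, and the cycles they close\<close>

lemma is_path_snoc:
  assumes "is_path G vs es" "z \<in> verts G" "z \<notin> set vs" "f \<in> edges G" "ends G f = {last vs, z}"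
  shows "is_path G (vs @ [z]) (es @ [f])"
proof -
  have len: "length vs = Suc (length es)" using assms by (simp add: is_path_def)
  then have "last vs = vs ! length es"
    by (metis One_nat_def diff_Suc_1 last_conv_nth length_0_conv nat.distinct(1))
  then show ?thesis
    using assms len unfolding is_path_def by (auto simp: nth_append less_Suc_eq)
qed

lemma is_path_take:
  assumes "is_path G vs es" "i < length vs"
  shows "is_path G (take (Suc i) vs) (take i es)"
  using assms unfolding is_path_def
  by (auto dest: in_set_takeD)

lemma is_path_drop:
  assumes "is_path G vs es" "i < length vs"
  shows "is_path G (drop i vs) (drop i es)"
  using assms unfolding is_path_def
  by (auto dest: in_set_dropD)

text \<open>When the next vertex of the walk already lies on the path, the path is cut back to that
  vertex instead of being extended.\<close>

lemma reach_imp_path: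
  assumes "signed_graph G" "x \<in> verts G" "(x, y) \<in> (adj G)\<^sup>*"
  shows "\<exists>vs es. is_path G vs es \<and> hd vs = x \<and> last vs = y"
  using assms(3)
proof (induction rule: rtrancl_induct)
  case base
  have "is_path G [x] []" using assms by (simp add: is_path_def)
  then show ?case by fastforce
next
  case (step y z)
  then obtain vs es where p: "is_path G vs es" "hd vs = x" "last vs = y" by blast
  obtain f where f: "f \<in> edges G" "ends G f = {y, z}" using step by (auto simp: adj_def)
  have ne: "vs \<noteq> []" using p by (auto simp: is_path_def)
  show ?case
  proof (cases "z \<in> set vs")
    case True
    then obtain i where i: "i < length vs" "vs ! i = z" by (auto simp: in_set_conv_nth)
    have "last (take (Suc i) vs) = z" using i by (simp add: take_Suc_conv_app_nth)
    moreover have "hd (take (Suc i) vs) = x" using p ne by (cases vs) auto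
    ultimately show ?thesis using is_path_take[OF p(1) i(1)] by blast
  next
    case False
    have "is_path G (vs @ [z]) (es @ [f])"
      using is_path_snoc[OF p(1)] False f p adj_in_verts[OF assms(1) step.hyps(2)] by simp
    then show ?thesis using p ne by (metis hd_append2 last_snoc)
  qed
qed

lemma path_imp_reach:
  assumes "is_path G vs es" "i < length vs"
  shows "(hd vs, vs ! i) \<in> (adj G)\<^sup>*"
  using assms(2)
proof (induction i)
  case 0
  then show ?case by (simp add: hd_conv_nth)
next
  case (Suc i)
  then have "ends G (es ! i) = {vs ! i, vs ! Suc i}" "es ! i \<in> edges G"
    using assms(1) by (auto simp: is_path_def)
  then have "(vs ! i, vs ! Suc i) \<in> (adj G)\<^sup>*" using reach_edge by metis
  then show ?case using Suc reach_trans by (metis Suc_lessD)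
qed

text \<open>The product telescopes: the label of an interior vertex occurs in the signs of both path
  edges there and cancels. The induction runs over the prefixes of the path.\<close>

lemma path_sign_product:
  assumes "potential G C p" "is_path G vs es" "set vs \<subseteq> C"
  shows "sign_product G es = p (hd vs) * p (last vs)"
proof -
  have "p x \<in> {-1, 1}" for x using assms by (simp add: potential_def)
  then have sq: "p x * p x = 1" for x by (metis insertE minus_mult_minus mult_1 singletonD)
  have "i < length vs \<Longrightarrow> sign_product G (take i es) = p (hd vs) * p (vs ! i)" for i
  proof (induction i)
    case 0
    then show ?case using sq by (simp add: hd_conv_nth sign_product_def)
  next
    case (Suc i)
    then have i: "i < length es" "ends G (es ! i) = {vs ! i, vs ! Suc i}" "es ! i \<in> edges G"
        "vs ! i \<in> C"
      using assms(2,3) by (auto simp: is_path_def)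
    then have "sign G (es ! i) = p (vs ! i) * p (vs ! Suc i)"
      using assms(1) unfolding potential_def by blast
    then have "sign_product G (take (Suc i) es) =
        p (hd vs) * (p (vs ! i) * p (vs ! i)) * p (vs ! Suc i)"
      using Suc i by (simp add: take_Suc_conv_app_nth sign_product_def)
    then show ?case using sq by simp
  qed
  moreover have "length vs = Suc (length es)" using assms(2) by (simp add: is_path_def)
  ultimately show ?thesis
    by (metis diff_Suc_1 last_conv_nth length_0_conv lessI nat.distinct(1) order_refl take_all)
qed

text \<open>\<open>is_path\<close> only asks for distinct vertices, but \<open>is_cycle\<close> also
  for distinct edges. A repeated edge would have equal end pairs at two positions; matching them
  crosswise would give both \<open>i = Suc j\<close> and \<open>j = Suc i\<close>.\<close>

lemma is_path_distinct_edges: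
  assumes "is_path G vs es"
  shows "distinct es"
proof -
  have p: "length vs = Suc (length es)" "distinct vs"
    "\<And>i. i < length es \<Longrightarrow> ends G (es ! i) = {vs ! i, vs ! Suc i}"
    using assms by (auto simp: is_path_def)
  have "i = j" if "i < length es" "j < length es" "es ! i = es ! j" for i j
  proof -
    have "{vs ! i, vs ! Suc i} = {vs ! j, vs ! Suc j}" using p(3) that by metis
    then have "vs ! i = vs ! j \<or> vs ! i = vs ! Suc j \<and> vs ! Suc i = vs ! j"
      by (auto simp: doubleton_eq_iff)
    then show ?thesis using that p(1,2) by (auto simp: nth_eq_iff_index_eq)
  qed
  then show ?thesis by (auto simp: distinct_conv_nth)
qed

text \<open>Taking the path in \<open>delete G e\<close> keeps \<open>e\<close> from occurring
  twice. A path with one vertex and no edges is included, in which case \<open>e\<close> is a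
  loop.\<close>

lemma path_closing_cycle:
  assumes "is_path (delete G e) vs es" "e \<in> edges G" "ends G e = {hd vs, last vs}"
  shows "is_cycle G vs (es @ [e])"
proof -
  have p: "length vs = Suc (length es)" "distinct vs" "set vs \<subseteq> verts G" "set es \<subseteq> edges G - {e}"
    "\<And>i. i < length es \<Longrightarrow> ends G (es ! i) = {vs ! i, vs ! Suc i}"
    using assms by (auto simp: is_path_def)
  have "last vs = vs ! length es" "hd vs = vs ! 0"
    using p(1) by (metis diff_Suc_1 last_conv_nth length_0_conv nat.distinct(1),
        metis hd_conv_nth length_0_conv nat.distinct(1))
  then show ?thesis
    using p assms(2,3) is_path_distinct_edges[OF assms(1)]
    unfolding is_cycle_def by (auto simp: nth_append less_Suc_eq insert_commute mod_Suc)
qed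

lemma is_cycle_delete: "is_cycle (delete G e) vs es \<Longrightarrow> is_cycle G vs es"
  by (auto simp: is_cycle_def)

lemma balanced_component_delete:
  "balanced_component G C \<Longrightarrow> D \<subseteq> C \<Longrightarrow> balanced_component (delete G e) D"
  unfolding balanced_component_def balanced_cycle_def sign_product_def
  using is_cycle_delete by fastforce

section \<open>Extending potentials over an added edge\<close>

lemma potential_other:
  assumes "potential (delete G e) C p" "ends G e \<inter> C = {}"
  shows "potential G C p"
  using assms unfolding potential_def by fastforce

text \<open>Negating a potential on a whole component gives a potential again. With the ends of
  \<open>e\<close> in different components of \<open>H\<close>, one of the two potentials can thus
  be adjusted to match the sign of \<open>e\<close>.\<close>

lemma potential_merge:
  assumes sg: "signed_graph G" and e: "e \<in> edges G" "ends G e = {u, v}"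
    and V: "u \<in> verts G" "v \<in> verts G"
  defines "H \<equiv> delete G e"
  assumes ne: "comp_of H u \<noteq> comp_of H v"
    and p: "potential H (comp_of H u) p" and q: "potential H (comp_of H v) q"
  shows "\<exists>r. potential G (comp_of H u \<union> comp_of H v) r"
proof -
  let ?U = "comp_of H u" and ?W = "comp_of H v"
  have sH: "signed_graph H" by (simp add: H_def sg signed_graph_delete)
  have vH: "verts H = verts G" by (simp add: H_def)
  have UW: "?U \<in> components H" "?W \<in> components H" "u \<in> ?U" "v \<in> ?W"
    using V vH by (auto intro: comp_of_in_components comp_of_self)
  have disj: "x \<notin> ?W" if "x \<in> ?U" for x
    using ne component_of_mem[OF UW(1) that] component_of_mem[OF UW(2)] by metis
  have pm: "p x \<in> {-1, 1}" "q x \<in> {-1, 1}" for x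
    using p q by (auto simp: potential_def)
  have se: "sign G e \<in> {-1, 1}" using sg e by (auto simp: signed_graph_def)
  \<comment> \<open>This factor solves \<open>p u * (c * q v) = sign G e\<close>, as labels square
    to 1. It leaves the edges within the second component correct because
    \<open>c * c = 1\<close>.\<close>
  define c where "c = p u * q v * sign G e"
  define r where "r x = (if x \<in> ?U then p x else c * q x)" for x
  have c: "c \<in> {-1, 1}" using pm[of u] pm[of v] se by (auto simp: c_def)
  have r: "r x \<in> {-1, 1}" for x using c pm[of x] by (auto simp: r_def)
  have eq_e: "sign G e = r u * r v"
    using pm[of u] pm[of v] se UW disj by (auto simp: r_def c_def)
  have "sign G f = r a * r b" if f: "f \<in> edges G" "ends G f = {a, b}" "a \<in> ?U \<union> ?W" for f a b
  proof (cases "f = e")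
    case True
    then have "a = u \<and> b = v \<or> a = v \<and> b = u"
      using f e by (auto simp: doubleton_eq_iff)
    then show ?thesis using eq_e True by (auto simp: mult.commute)
  next
    case False
    then have fH: "f \<in> edges H" "ends H f = {a, b}" using f by (auto simp: H_def)
    show ?thesis
    proof (cases "a \<in> ?U")
      case True
      then have "b \<in> ?U" using component_closed[OF sH UW(1) fH] by blast
      moreover have "sign H f = p a * p b" using p fH True unfolding potential_def by blast
      ultimately show ?thesis using True by (simp add: r_def H_def)
    next
      case False
      then have a: "a \<in> ?W" using f by blast
      then have "b \<in> ?W" using component_closed[OF sH UW(2) fH] by blast
      then have "b \<notin> ?U" using disj by blast
      moreover have "sign H f = q a * q b" using q fH a unfolding potential_def by blast
      moreover have "c * c = 1" using c by auto
      ultimately show ?thesis using False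
        by (simp add: r_def H_def)
    qed
  qed
  then have "potential G (?U \<union> ?W) r" unfolding potential_def using r by blast
  then show ?thesis by blast
qed

text \<open>Induction on the number of edges, removing an arbitrary edge \<open>e\<close>. If
  \<open>e\<close> misses \<open>C\<close>, the potential is kept; if \<open>e\<close> joins two
  components of the smaller graph, their potentials are merged; if its ends are still connected
  there, balance forces the sign that the old potential prescribes for \<open>e\<close>.\<close>

lemma balanced_imp_potential:
  assumes "signed_graph G" "C \<in> components G" "balanced_component G C"
  shows "\<exists>p. potential G C p"
  using assms
proof (induction "card (edges G)" arbitrary: G C)
  case 0
  then have "potential G C (\<lambda>_. 1)"
    by (auto simp: potential_def signed_graph_def)
  then show ?case by blast
next
  case (Suc n)
  note sg = \<open>signed_graph G\<close>
  obtain e where e: "e \<in> edges G" using Suc.hyps(2) by fastforce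
  obtain u v where uv: "u \<in> verts G" "v \<in> verts G" "ends G e = {u, v}"
    using signed_graph_ends[OF sg e] .
  define H where "H = delete G e"
  have sH: "signed_graph H" by (simp add: H_def sg signed_graph_delete)
  have vH: "verts H = verts G" by (simp add: H_def)
  have "n = card (edges H)" using Suc.hyps(2) e sg by (simp add: H_def signed_graph_def)
  note IH = Suc.hyps(1)[OF this sH]
  have UW: "comp_of H u \<in> components H" "comp_of H v \<in> components H"
      "u \<in> comp_of H u" "v \<in> comp_of H v"
    using uv vH by (auto intro: comp_of_in_components comp_of_self)
  have bal: "balanced_component H D" if "D \<subseteq> C" for D
    unfolding H_def using balanced_component_delete[OF Suc.prems(3) that] .
  have "C \<in> insert (comp_of H u \<union> comp_of H v) (components H - {comp_of H u, comp_of H v})"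
    using Suc.prems(2) components_delete[OF e uv(3,1,2)] by (simp add: H_def)
  then consider "C = comp_of H u \<union> comp_of H v"
    | "C \<in> components H" "C \<noteq> comp_of H u" "C \<noteq> comp_of H v" by blast
  then show ?case
  proof cases
    case 2
    then obtain p where "potential H C p" using IH bal by blast
    moreover have "ends G e \<inter> C = {}"
      using 2 component_of_mem[OF 2(1)] uv by auto
    ultimately show ?thesis using potential_other[of G e C] by (auto simp: H_def)
  next
    case 1
    then obtain p q where p: "potential H (comp_of H u) p" and q: "potential H (comp_of H v) q"
      using IH UW bal by (metis Un_upper1 Un_upper2)
    show ?thesis
    proof (cases "comp_of H u = comp_of H v")
      case False
      then show ?thesis
        using potential_merge[OF sg e uv(3,1,2)] p q 1 unfolding H_def by blast
    next
      case True
      then have CU: "C = comp_of H u" using 1 by simp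
      have "(u, v) \<in> (adj H)\<^sup>*" using True comp_of_eq_iff uv vH by metis
      then obtain vs es where path: "is_path H vs es" "hd vs = u" "last vs = v"
        using reach_imp_path[OF sH] uv vH by metis
      have sub: "set vs \<subseteq> C"
      proof
        fix x assume x: "x \<in> set vs"
        then have "(u, x) \<in> (adj H)\<^sup>*"
          using path_imp_reach[OF path(1)] path(2) by (metis in_set_conv_nth)
        moreover have "x \<in> verts H" using x path(1) by (auto simp: is_path_def)
        ultimately show "x \<in> C" by (simp add: CU comp_of_def)
      qed
      \<comment> \<open>A single cycle through \<open>e\<close> suffices: its sign product is 1, and
        the part without \<open>e\<close> has sign \<open>p u * p v\<close>.\<close>
      have "is_cycle G vs (es @ [e])"
        using path_closing_cycle path e uv unfolding H_def by metis
      then have "sign_product G (es @ [e]) = 1"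
        using Suc.prems(3) sub by (auto simp: balanced_component_def balanced_cycle_def)
      moreover have "sign_product H es = p u * p v"
        using path_sign_product[OF p path(1)] sub path CU by simp
      ultimately have s: "p u * p v * sign G e = 1"
        by (simp add: sign_product_def H_def)
      have pm: "p x \<in> {-1, 1}" for x using p by (auto simp: potential_def)
      have se: "sign G e = p u * p v" using s pm[of u] pm[of v] by auto
      have "sign G f = p a * p b" if f: "f \<in> edges G" "ends G f = {a, b}" "a \<in> C" for f a b
      proof (cases "f = e")
        case True
        then have "a = u \<and> b = v \<or> a = v \<and> b = u"
          using f uv by (auto simp: doubleton_eq_iff)
        then show ?thesis using se True by (auto simp: mult.commute)
      next
        case False
        then show ?thesis using p f CU unfolding potential_def by (simp add: H_def)
      qed
      then have "potential G C p" using pm unfolding potential_def by blast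
      then show ?thesis by blast
    qed
  qed
qed

subsection \<open>Counting components\<close>

lemma card_filter_insert:
  assumes "finite D" "c \<notin> D"
  shows "card {x \<in> insert c D. P x} = card {x \<in> D. P x} + of_bool (P c)"
proof -
  have "{x \<in> insert c D. P x} = (if P c then insert c {x \<in> D. P x} else {x \<in> D. P x})" by auto
  then show ?thesis using assms by simp
qed

lemma num_comp_split: "signed_graph G \<Longrightarrow> num_comp G = num_bal G + num_unbal G"
proof -
  assume "signed_graph G"
  then have fin: "finite (components G)" by (rule finite_components)
  have "components G = {C \<in> components G. balanced_component G C} \<union>
      {C \<in> components G. \<not> balanced_component G C}" by blast
  then have "card (components G) = card ({C \<in> components G. balanced_component G C} \<union>
      {C \<in> components G. \<not> balanced_component G C})" by (rule arg_cong)
  also have "\<dots> = num_bal G + num_unbal G"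
    unfolding num_bal_def num_unbal_def using fin by (intro card_Un_disjoint) auto
  finally show ?thesis by (simp add: num_comp_def)
qed

section \<open>Effect of deleting one edge on the component counts\<close>

context
  fixes G H :: "('v, 'e) sgraph" and e :: 'e and u v :: 'v
  assumes sg: "signed_graph G" and e: "e \<in> edges G" and uv: "ends G e = {u, v}"
    and H: "H = delete G e"
begin

lemma ends_in_verts: "u \<in> verts G" "v \<in> verts G"
proof -
  obtain a b where "a \<in> verts G" "b \<in> verts G" "ends G e = {a, b}"
    using signed_graph_ends[OF sg e] .
  then show "u \<in> verts G" "v \<in> verts G" using uv by (auto simp: doubleton_eq_iff)
qed

lemma signed_graph_H: "signed_graph H"
  by (simp add: H sg signed_graph_delete)

lemma components_insert:
  "components G =
    insert (comp_of H u \<union> comp_of H v) (components H - {comp_of H u, comp_of H v})"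
  using components_delete[OF e uv ends_in_verts] by (simp add: H)

lemma end_comps: "comp_of H u \<in> components H" "comp_of H v \<in> components H"
  using ends_in_verts by (auto simp: H intro!: comp_of_in_components)

lemma balanced_other:
  assumes "C \<in> components H - {comp_of H u, comp_of H v}"
  shows "balanced_component G C \<longleftrightarrow> balanced_component H C"
proof
  show "balanced_component G C \<Longrightarrow> balanced_component H C"
    unfolding H by (rule balanced_component_delete) auto
next
  assume "balanced_component H C"
  then obtain p where "potential H C p"
    using balanced_imp_potential[OF signed_graph_H] assms by blast
  moreover have "ends G e \<inter> C = {}"
    using assms component_of_mem[of C H] uv by auto
  ultimately have "potential G C p" using potential_other[of G e C] by (auto simp: H)
  then show "balanced_component G C" by (rule potential_imp_balanced)
qed

text \<open>Cycles of either part are cycles of \<open>G\<close>. For the converse, merging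
  potentials replaces a discussion of which cycles of \<open>G\<close> could run through
  \<open>e\<close>.\<close>

lemma balanced_union:
  assumes "comp_of H u \<noteq> comp_of H v"
  shows "balanced_component G (comp_of H u \<union> comp_of H v) \<longleftrightarrow>
    balanced_component H (comp_of H u) \<and> balanced_component H (comp_of H v)"
proof
  show "balanced_component G (comp_of H u \<union> comp_of H v) \<Longrightarrow>
    balanced_component H (comp_of H u) \<and> balanced_component H (comp_of H v)"
    unfolding H by (auto intro: balanced_component_delete)
next
  assume "balanced_component H (comp_of H u) \<and> balanced_component H (comp_of H v)"
  then obtain p q where "potential H (comp_of H u) p" "potential H (comp_of H v) q"
    using balanced_imp_potential[OF signed_graph_H] end_comps by blast
  then obtain r where "potential G (comp_of H u \<union> comp_of H v) r"
    using potential_merge[OF sg e uv ends_in_verts] assms H by blast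
  then show "balanced_component G (comp_of H u \<union> comp_of H v)" by (rule potential_imp_balanced)
qed

private abbreviation (input) "others \<equiv> components H - {comp_of H u, comp_of H v}"

lemma finite_others: "finite others"
  using finite_components[OF signed_graph_H] by simp

lemma union_notin_others: "comp_of H u \<union> comp_of H v \<notin> others"
  using union_notin_other_components[of u H] ends_in_verts by (simp add: H)

text \<open>The components away from \<open>e\<close> are common to \<open>G\<close> and
  \<open>H\<close> and have the same balance, so every comparison of counts reduces to the
  components at the ends of \<open>e\<close>.\<close>

lemma num_bal_insert:
  "num_bal G = card {C \<in> others. balanced_component H C} +
    of_bool (balanced_component G (comp_of H u \<union> comp_of H v))"
proof -
  have "{C \<in> others. balanced_component G C} = {C \<in> others. balanced_component H C}"
    using balanced_other by blast
  then show ?thesis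
    unfolding num_bal_def components_insert
    by (simp only: card_filter_insert[OF finite_others union_notin_others])
qed

lemma num_comp_insert: "num_comp G = Suc (card others)"
  unfolding num_comp_def components_insert using finite_others union_notin_others by simp

lemma num_comp_bridge:
  assumes "comp_of H u \<noteq> comp_of H v"
  shows "num_comp H = Suc (num_comp G)"
proof -
  have "components H = insert (comp_of H u) (insert (comp_of H v) others)"
    using end_comps by auto
  then have "card (components H) = card (insert (comp_of H u) (insert (comp_of H v) others))"
    by (rule arg_cong)
  also have "\<dots> = Suc (Suc (card others))" using finite_others assms by simp
  finally show ?thesis using num_comp_insert by (simp add: num_comp_def)
qed

text \<open>The two end components count separately in \<open>H\<close>, and in \<open>G\<close> as
  one that is balanced iff both are. The difference of the counts is the indicator of the
  disjunction.\<close>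

lemma num_bal_bridge:
  assumes "comp_of H u \<noteq> comp_of H v"
  shows "num_bal H = num_bal G +
    of_bool (balanced_component H (comp_of H u) \<or> balanced_component H (comp_of H v))"
proof -
  have "components H = insert (comp_of H u) (insert (comp_of H v) others)"
    using end_comps by auto
  then have "num_bal H =
      card {C \<in> insert (comp_of H u) (insert (comp_of H v) others). balanced_component H C}"
    unfolding num_bal_def by (rule arg_cong[where f = "\<lambda>S. card {C \<in> S. balanced_component H C}"])
  also have "\<dots> = card {C \<in> others. balanced_component H C} +
      of_bool (balanced_component H (comp_of H v)) + of_bool (balanced_component H (comp_of H u))"
    using finite_others assms by (subst card_filter_insert, simp, simp)+ simp
  finally show ?thesis
    using num_bal_insert balanced_union[OF assms] by auto
qed

lemma num_comp_same:
  assumes "comp_of H u = comp_of H v"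
  shows "num_comp H = num_comp G"
proof -
  have "components H = insert (comp_of H u) others"
    using end_comps assms by auto
  then have "components H = components G" using components_insert assms by simp
  then show ?thesis by (simp add: num_comp_def)
qed

text \<open>Stated as an equation of sums, which avoids truncated subtraction: each side is the
  common contribution of the other components plus both indicators.\<close>

lemma num_bal_same:
  assumes "comp_of H u = comp_of H v"
  shows "num_bal H + of_bool (balanced_component G (comp_of H u)) =
    num_bal G + of_bool (balanced_component H (comp_of H u))"
proof -
  have "components H = insert (comp_of H u) others"
    using end_comps assms by auto
  then have "num_bal H = card {C \<in> insert (comp_of H u) others. balanced_component H C}"
    unfolding num_bal_def by (rule arg_cong[where f = "\<lambda>S. card {C \<in> S. balanced_component H C}"])
  also have "\<dots> = card {C \<in> others. balanced_component H C} +
      of_bool (balanced_component H (comp_of H u))"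
    using finite_others by (subst card_filter_insert) simp_all
  finally show ?thesis using num_bal_insert assms by simp
qed

lemma num_comp_delete: "num_comp G \<le> num_comp H"
  using num_comp_same num_comp_bridge by fastforce

text \<open>In matroid terms, adding one edge raises the rank
  \<open>card (verts G) - num_bal G\<close> by at most one.\<close>

lemma num_bal_delete: "num_bal H \<le> Suc (num_bal G)"
  using num_bal_same num_bal_bridge
  by (cases "comp_of H u = comp_of H v") (fastforce simp: of_bool_def split: if_splits)+

text \<open>A potential survives the addition of the loop, whose condition
  \<open>p u * p u = 1\<close> holds for any sign label.\<close>

lemma num_bal_positive_loop:
  assumes "u = v" "sign G e = 1"
  shows "num_bal H = num_bal G"
proof -
  have "balanced_component G (comp_of H u)" if bal: "balanced_component H (comp_of H u)"
  proof -
    obtain p where p: "potential H (comp_of H u) p"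
      using bal balanced_imp_potential[OF signed_graph_H] end_comps by blast
    have "p u \<in> {-1, 1}" using p by (simp add: potential_def)
    then have pu: "p u * p u = 1" by auto
    have "sign G f = p a * p b" if "f \<in> edges G" "ends G f = {a, b}" "a \<in> comp_of H u" for f a b
    proof (cases "f = e")
      case True
      then show ?thesis using that uv assms pu by (auto simp: doubleton_eq_iff)
    next
      case False
      then show ?thesis using p that unfolding potential_def by (simp add: H)
    qed
    then have "potential G (comp_of H u) p" using p unfolding potential_def by blast
    then show ?thesis by (rule potential_imp_balanced)
  qed
  moreover have "balanced_component H (comp_of H u)" if "balanced_component G (comp_of H u)"
    using balanced_component_delete[OF that] by (simp add: H)
  ultimately have "balanced_component G (comp_of H u) = balanced_component H (comp_of H u)" by blast
  then show ?thesis using num_bal_same assms(1) by simp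
qed

lemma bridge_iff:
  "is_bridge G e \<longleftrightarrow> comp_of H u \<noteq> comp_of H v"
proof
  show "is_bridge G e \<Longrightarrow> comp_of H u \<noteq> comp_of H v"
    using num_comp_same by (auto simp: is_bridge_def H)
next
  assume ne: "comp_of H u \<noteq> comp_of H v"
  then have "\<not> is_loop G e" using uv by (auto simp: is_loop_def)
  then show "is_bridge G e" using e num_comp_bridge[OF ne] by (simp add: is_bridge_def H)
qed

end

section \<open>Exactness of the exponents under natural subtraction\<close>

lemma num_comp_spanning:
  assumes "signed_graph G" "A \<subseteq> edges G"
  shows "num_comp G \<le> num_comp (spanning G A)"
  using assms
proof (induction "card (edges G)" arbitrary: G rule: less_induct)
  case less
  show ?case
  proof (cases "A = edges G")
    case False
    then obtain e where e: "e \<in> edges G" "e \<notin> A" using less.prems by blast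
    obtain u v where "ends G e = {u, v}" using signed_graph_ends[OF less.prems(1) e(1)] .
    then have "num_comp G \<le> num_comp (delete G e)"
      using num_comp_delete[OF less.prems(1) e(1)] by blast
    also have "card (edges (delete G e)) < card (edges G)"
      using e less.prems card_Diff1_less[of "edges G" e] by (simp add: signed_graph_def)
    then have "num_comp (delete G e) \<le> num_comp (spanning (delete G e) A)"
      using less.prems e signed_graph_delete by (intro less.hyps) auto
    finally show ?thesis by simp
  qed simp
qed

lemma components_no_edges: "edges G = {} \<Longrightarrow> components G = (\<lambda>x. {x}) ` verts G"
proof -
  assume "edges G = {}"
  then have "adj G = {}" by (simp add: adj_def)
  then show ?thesis by (auto simp: components_eq comp_of_def)
qed

lemma balanced_no_edges: "edges G = {} \<Longrightarrow> balanced_component G C"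
  by (auto simp: balanced_component_def is_cycle_def)

lemma num_bal_no_edges: "edges G = {} \<Longrightarrow> num_bal G = card (verts G)"
  by (simp add: num_bal_def components_no_edges balanced_no_edges card_image)

text \<open>Without edges every vertex is a balanced component, giving equality. Each further edge
  adds one to the edge count and costs at most one balanced component.\<close>

lemma card_verts_le:
  assumes "signed_graph G"
  shows "card (verts G) \<le> card (edges G) + num_bal G"
  using assms
proof (induction "card (edges G)" arbitrary: G)
  case 0
  then have "edges G = {}" by (simp add: signed_graph_def)
  then show ?case by (simp add: num_bal_no_edges)
next
  case (Suc n)
  then obtain e where e: "e \<in> edges G" by fastforce
  obtain u v where uv: "ends G e = {u, v}" using signed_graph_ends[OF Suc.prems e] .
  have n: "n = card (edges (delete G e))"
    using Suc.hyps(2) e Suc.prems by (simp add: signed_graph_def)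
  have "card (verts G) \<le> card (edges (delete G e)) + num_bal (delete G e)"
    using Suc.hyps(1)[OF n signed_graph_delete[OF Suc.prems]] by simp
  then show ?case
    using num_bal_delete[OF Suc.prems e uv refl] n Suc.hyps(2) by linarith
qed

subsection \<open>Contraction\<close>

lemma contract_sel [simp]:
  "verts (contract G e) = contract_vertex G e ` verts G" "edges (contract G e) = edges G - {e}"
  "ends (contract G e) = (\<lambda>f. contract_vertex G e ` ends G f)" "sign (contract G e) = sign G"
  by (simp_all add: contract_def)

text \<open>Restriction commutes with contraction once \<open>e\<close> is put back. Hence a subset
  \<open>B\<close> of the edges of the contraction corresponds to the subset
  \<open>insert e B\<close> of the original edges.\<close>

lemma spanning_contract:
  "e \<notin> B \<Longrightarrow> spanning (contract G e) B = contract (spanning G (insert e B)) e"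
  by (auto simp: contract_def spanning_def contract_vertex_def)

lemma signed_graph_contract: "signed_graph G \<Longrightarrow> signed_graph (contract G e)"
  unfolding signed_graph_def by fastforce

context
  fixes G :: "('v, 'e) sgraph" and e :: 'e and u v :: 'v and \<pi> :: "'v \<Rightarrow> 'v set"
  assumes sg: "signed_graph G" and e: "e \<in> edges G" and uv: "ends G e = {u, v}"
    and pi: "\<pi> = contract_vertex G e"
begin

lemma contract_vertex_eqD: "\<pi> x = \<pi> y \<Longrightarrow> x = y \<or> {x, y} \<subseteq> {u, v}"
  unfolding pi contract_vertex_def uv by (auto split: if_splits simp: doubleton_eq_iff)

lemma contract_vertex_eq_reach: "\<pi> x = \<pi> y \<Longrightarrow> (x, y) \<in> (adj G)\<^sup>*"
  using contract_vertex_eqD[of x y] reach_edge[OF e uv] reach_sym by fastforce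

lemma reach_contract: "(\<pi> x, \<pi> y) \<in> (adj (contract G e))\<^sup>* \<longleftrightarrow> (x, y) \<in> (adj G)\<^sup>*"
proof
  assume "(\<pi> x, \<pi> y) \<in> (adj (contract G e))\<^sup>*"
  \<comment> \<open>The walk is lifted edge by edge. Lifts of consecutive edges may meet the
    contracted block at different vertices, so the claim covers every preimage of \<open>b\<close>;
    two such preimages are joined by \<open>e\<close>.\<close>
  moreover have "(\<pi> x, b) \<in> (adj (contract G e))\<^sup>* \<Longrightarrow> \<forall>y. \<pi> y = b \<longrightarrow> (x, y) \<in> (adj G)\<^sup>*" for b
  proof (induction rule: rtrancl_induct)
    case base
    then show ?case using contract_vertex_eq_reach by metis
  next
    case (step b c)
    then obtain f where f: "f \<in> edges G" "\<pi> ` ends G f = {b, c}" by (auto simp: adj_def pi)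
    obtain s' t' where "ends G f = {s', t'}" using signed_graph_ends[OF sg f(1)] .
    then obtain s t where st: "ends G f = {s, t}" "\<pi> s = b" "\<pi> t = c"
      using f by (auto simp: doubleton_eq_iff)
    show ?case
    proof (intro allI impI)
      fix y assume "\<pi> y = c"
      then have "(t, y) \<in> (adj G)\<^sup>*" using st contract_vertex_eq_reach by metis
      then show "(x, y) \<in> (adj G)\<^sup>*"
        using reach_edge[OF f(1) st(1)] step.IH st(2) reach_trans by metis
    qed
  qed
  ultimately show "(x, y) \<in> (adj G)\<^sup>*" by blast
next
  assume "(x, y) \<in> (adj G)\<^sup>*"
  then show "(\<pi> x, \<pi> y) \<in> (adj (contract G e))\<^sup>*"
  proof (induction rule: rtrancl_induct)
    case (step y z)
    then obtain f where f: "f \<in> edges G" "ends G f = {y, z}" by (auto simp: adj_def)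
    show ?case
    proof (cases "f = e")
      case True
      then have "\<pi> y = \<pi> z" using f by (simp add: pi contract_vertex_def)
      then show ?thesis using step.IH by simp
    next
      case False
      then have "(\<pi> y, \<pi> z) \<in> adj (contract G e)"
        using f by (auto simp: adj_def pi intro!: bexI[of _ f])
      then show ?thesis using step.IH by (rule rtrancl_into_rtrancl[rotated])
    qed
  qed simp
qed

lemma comp_of_contract: "x \<in> verts G \<Longrightarrow> comp_of (contract G e) (\<pi> x) = \<pi> ` comp_of G x"
  unfolding comp_of_def using reach_contract by (auto simp: pi)

lemma components_contract: "components (contract G e) = image \<pi> ` components G"
  unfolding components_eq using comp_of_contract by (force simp: pi image_image)

text \<open>Vertices with the same block are connected in \<open>G\<close>, so images of distinct
  components share no block.\<close>

lemma inj_on_components: "inj_on (image \<pi>) (components G)"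
proof (rule inj_onI)
  fix C D assume CD: "C \<in> components G" "D \<in> components G" "\<pi> ` C = \<pi> ` D"
  then obtain x y where "x \<in> C" "y \<in> D" "\<pi> x = \<pi> y"
    using component_nonempty by (metis all_not_in_conv image_iff)
  then show "C = D"
    using CD component_of_mem comp_of_cong contract_vertex_eq_reach by metis
qed

lemma num_comp_contract: "num_comp (contract G e) = num_comp G"
  unfolding num_comp_def components_contract by (rule card_image[OF inj_on_components])

text \<open>Potentials pull back along \<open>\<pi>\<close>, since a positive \<open>e\<close> only
  asks for equal labels at its ends. Conversely, a potential of \<open>G\<close> has equal labels
  there and descends to the blocks.\<close>

lemma balanced_contract:
  assumes C: "C \<in> components G" and s: "sign G e = 1"
  shows "balanced_component (contract G e) (\<pi> ` C) \<longleftrightarrow> balanced_component G C"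
proof
  assume "balanced_component (contract G e) (\<pi> ` C)"
  then obtain p where p: "potential (contract G e) (\<pi> ` C) p"
    using balanced_imp_potential[OF signed_graph_contract[OF sg]] C components_contract by blast
  have pm: "p x \<in> {-1, 1}" for x using p by (simp add: potential_def)
  have "sign G f = p (\<pi> a) * p (\<pi> b)" if f: "f \<in> edges G" "ends G f = {a, b}" "a \<in> C" for f a b
  proof (cases "f = e")
    case True
    then have "\<pi> a = \<pi> b" using f by (simp add: pi contract_vertex_def)
    then show ?thesis using True s pm[of "\<pi> b"] by auto
  next
    case False
    then have "f \<in> edges (contract G e)" "ends (contract G e) f = {\<pi> a, \<pi> b}"
      using f by (auto simp: pi)
    then show ?thesis using p f(3) unfolding potential_def by (metis contract_sel(4) imageI)
  qed
  then have "potential G C (p \<circ> \<pi>)" using pm by (simp add: potential_def)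
  then show "balanced_component G C" by (rule potential_imp_balanced)
next
  assume "balanced_component G C"
  then obtain p where p: "potential G C p"
    using balanced_imp_potential[OF sg C] by blast
  have pm: "p x \<in> {-1, 1}" for x using p by (simp add: potential_def)
  \<comment> \<open>The label of a block is read off at a chosen representative. For blocks that
    meet \<open>C\<close> the choice is immaterial, because \<open>sign G e = 1\<close> forces equal
    labels at the ends of \<open>e\<close>.\<close>
  define q where "q B = p (SOME x. x \<in> B)" for B
  have q: "q (\<pi> x) = p x" if x: "x \<in> C" for x
  proof -
    have "x \<in> \<pi> x" by (simp add: pi contract_vertex_def)
    then have y: "(SOME y. y \<in> \<pi> x) \<in> \<pi> x" by (rule someI)
    let ?y = "SOME y. y \<in> \<pi> x"
    have "?y = x \<or> {x, ?y} = ends G e"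
      using y uv by (auto simp: pi contract_vertex_def split: if_splits)
    then show ?thesis
    proof
      assume "{x, ?y} = ends G e"
      then have "1 = p x * p ?y" using p e x s unfolding potential_def by metis
      then show ?thesis unfolding q_def using pm[of x] pm[of ?y] by auto
    qed (simp add: q_def)
  qed
  have "sign G f = q a * q b"
    if f: "f \<in> edges G" "\<pi> ` ends G f = {a, b}" "a \<in> \<pi> ` C" for f a b
  proof -
    obtain s' t' where "ends G f = {s', t'}" using signed_graph_ends[OF sg f(1)] .
    then obtain s t where st: "ends G f = {s, t}" "\<pi> s = a" "\<pi> t = b"
      using f by (auto simp: doubleton_eq_iff)
    obtain x where x: "x \<in> C" "\<pi> x = a" using f by blast
    \<comment> \<open>The vertex \<open>x\<close> witnessing that \<open>a\<close> lies in the image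
      of \<open>C\<close> may be the other end of \<open>e\<close> than \<open>s\<close>;
      \<open>e\<close> itself connects the two, which puts \<open>s\<close> into
      \<open>C\<close>.\<close>
    have "(x, s) \<in> (adj G)\<^sup>*" using st x contract_vertex_eq_reach by metis
    moreover have "s \<in> verts G"
      using signed_graph_ends[OF sg f(1)] st(1) by (metis insertE insertI1 singletonD)
    ultimately have "s \<in> C" using component_of_mem[OF C x(1)] by (simp add: comp_of_def)
    moreover have "t \<in> C" using component_closed[OF sg C f(1) st(1)] \<open>s \<in> C\<close> .
    ultimately show ?thesis using p q st f(1) unfolding potential_def by metis
  qed
  moreover have "q B \<in> {-1, 1}" for B using pm by (simp add: q_def)
  ultimately have "potential (contract G e) (\<pi> ` C) q"
    by (simp add: potential_def pi[symmetric])
  then show "balanced_component (contract G e) (\<pi> ` C)" by (rule potential_imp_balanced)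
qed

lemma num_bal_contract:
  assumes "sign G e = 1"
  shows "num_bal (contract G e) = num_bal G"
proof -
  have "{C \<in> components (contract G e). balanced_component (contract G e) C} =
      image \<pi> ` {C \<in> components G. balanced_component G C}"
    unfolding components_contract using balanced_contract assms by blast
  then show ?thesis
    unfolding num_bal_def
    using card_image[OF inj_on_subset[OF inj_on_components]]
    by (metis (no_types, lifting) mem_Collect_eq subsetI)
qed

lemma num_unbal_contract:
  assumes "sign G e = 1"
  shows "num_unbal (contract G e) = num_unbal G"
  using num_comp_split[OF sg] num_comp_split[OF signed_graph_contract[OF sg]]
    num_comp_contract num_bal_contract[OF assms] by (metis add_left_cancel)

text \<open>Dropping \<open>v\<close> loses no block, and \<open>\<pi>\<close> is injective on the
  remaining vertices because it identifies only \<open>u\<close> and \<open>v\<close>.\<close>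

lemma card_verts_contract:
  assumes "u \<noteq> v"
  shows "card (verts G) = Suc (card (verts (contract G e)))"
proof -
  have fin: "finite (verts G)" using sg by (simp add: signed_graph_def)
  have V: "u \<in> verts G" "v \<in> verts G" using ends_in_verts[OF sg e uv refl] .
  have "\<pi> v = \<pi> u" by (simp add: pi contract_vertex_def uv)
  moreover have "u \<in> verts G - {v}" using V assms by simp
  ultimately have "\<pi> v \<in> \<pi> ` (verts G - {v})" by (metis imageI)
  then have "\<pi> ` verts G = \<pi> ` (verts G - {v})"
    using insert_Diff[OF V(2)] by (metis image_insert insert_absorb)
  moreover have "inj_on \<pi> (verts G - {v})"
    by (rule inj_onI) (use contract_vertex_eqD in blast)
  ultimately have "card (verts (contract G e)) = card (verts G - {v})"
    by (simp add: pi[symmetric] card_image)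
  then show ?thesis using card_Suc_Diff1[OF fin V(2)] by simp
qed

end

subsection \<open>Handcuffs through a bridge\<close>

text \<open>The two end components contain unbalanced cycles, which the bridge \<open>e\<close>
  separates in \<open>G\<close>. Every path between them therefore uses \<open>e\<close>, and one of
  minimal length meets each cycle only at its endpoint.\<close>

lemma unbalanced_ends_imp_circuit_path_edge:
  assumes sg: "signed_graph G" and e: "e \<in> edges G" "ends G e = {u, v}" and br: "is_bridge G e"
    and A: "A \<subseteq> edges G - {e}"
    and un: "\<not> balanced_component (spanning G A) (comp_of (spanning G A) u)"
      "\<not> balanced_component (spanning G A) (comp_of (spanning G A) v)"
  shows "circuit_path_edge G e"
proof -
  let ?S = "spanning G A" and ?H = "delete G e"
  have V: "u \<in> verts G" "v \<in> verts G" using ends_in_verts[OF sg e refl] .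
  have ne: "comp_of ?H u \<noteq> comp_of ?H v" using br bridge_iff[OF sg e refl] by blast
  have "(adj ?S)\<^sup>* \<subseteq> (adj ?H)\<^sup>*"
    using A by (intro rtrancl_mono) (auto simp: adj_def)
  then have sub: "comp_of ?S w \<subseteq> comp_of ?H w" for w by (auto simp: comp_of_def)
  have unb: "\<exists>vs es. unbalanced_cycle G vs es \<and> set vs \<subseteq> comp_of ?H w"
    if unbal: "\<not> balanced_component ?S (comp_of ?S w)" for w
  proof -
    obtain vs es where "is_cycle ?S vs es" "set vs \<subseteq> comp_of ?S w" "sign_product ?S es \<noteq> 1"
      using unbal unfolding balanced_component_def balanced_cycle_def by blast
    moreover from this have "unbalanced_cycle G vs es"
      using A by (auto simp: unbalanced_cycle_def is_cycle_def sign_product_def)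
    ultimately show ?thesis using sub by blast
  qed
  obtain vs1 es1 where c1: "unbalanced_cycle G vs1 es1" "set vs1 \<subseteq> comp_of ?H u"
    using unb un by blast
  obtain vs2 es2 where c2: "unbalanced_cycle G vs2 es2" "set vs2 \<subseteq> comp_of ?H v"
    using unb un by blast
  \<comment> \<open>This separation gives both the disjointness of the two cycles and the presence
    of \<open>e\<close> on the connecting path.\<close>
  have no_reach: False if "x \<in> set vs1" "y \<in> set vs2" "(x, y) \<in> (adj ?H)\<^sup>*" for x y
  proof -
    have "comp_of ?H x = comp_of ?H u" "comp_of ?H y = comp_of ?H v"
      using that c1 c2 comp_of_cong[of u x ?H] comp_of_cong[of v y ?H] by (auto simp: comp_of_def)
    then show False using ne comp_of_cong[OF that(3)] by simp
  qed
  define P where "P vs es \<longleftrightarrow> is_path G vs es \<and> hd vs \<in> set vs1 \<and> last vs \<in> set vs2" for vs es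
  have ex: "\<exists>vs es. P vs es"
  proof -
    obtain x y where xy: "x \<in> set vs1" "y \<in> set vs2"
      using c1 c2 by (metis is_cycle_def list.set_sel(1) unbalanced_cycle_def)
    have "(u, x) \<in> (adj ?H)\<^sup>*" "(v, y) \<in> (adj ?H)\<^sup>*" "x \<in> verts G"
      using xy c1 c2 by (auto simp: comp_of_def)
    then have "(x, y) \<in> (adj G)\<^sup>*"
      using reach_delete[OF e] reach_sym by metis
    then show ?thesis
      using reach_imp_path[OF sg \<open>x \<in> verts G\<close>] xy unfolding P_def by metis
  qed
  define n where "n = (LEAST n. \<exists>vs es. P vs es \<and> length vs = n)"
  have "\<exists>vs es. P vs es \<and> length vs = n"
    unfolding n_def by (rule LeastI_ex) (use ex in blast)
  then obtain ps qs where ps: "P ps qs" "length ps = n" by blast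
  have min: "length ps \<le> length vs" if "P vs es" for vs es
    unfolding ps(2) n_def by (rule Least_le) (use that in blast)
  have path: "is_path G ps qs" "hd ps \<in> set vs1" "last ps \<in> set vs2" using ps by (auto simp: P_def)
  have nonempty: "ps \<noteq> []" using path by (auto simp: is_path_def)
  \<comment> \<open>Starting at a later visit to the first cycle would give a shorter admissible
    path; likewise below, stopping at an earlier visit to the second cycle.\<close>
  have "i = 0" if i: "i < length ps" "ps ! i \<in> set vs1" for i
  proof -
    have "P (drop i ps) (drop i qs)"
      using is_path_drop[OF path(1) i(1)] i path by (simp add: P_def hd_drop_conv_nth)
    from min[OF this] show ?thesis using i by simp
  qed
  then have "x = hd ps" if "x \<in> set ps" "x \<in> set vs1" for x
    using that nonempty by (metis hd_conv_nth in_set_conv_nth)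
  then have m1: "set ps \<inter> set vs1 = {hd ps}" using path nonempty by auto
  have "Suc i = length ps" if i: "i < length ps" "ps ! i \<in> set vs2" for i
  proof -
    have "P (take (Suc i) ps) (take i qs)"
      using is_path_take[OF path(1) i(1)] i path nonempty
      by (simp add: P_def take_Suc_conv_app_nth[symmetric] last_conv_nth)
    from min[OF this] show ?thesis using i by simp
  qed
  then have "x = last ps" if "x \<in> set ps" "x \<in> set vs2" for x
    using that nonempty by (metis diff_Suc_1 in_set_conv_nth last_conv_nth)
  then have m2: "set ps \<inter> set vs2 = {last ps}" using path nonempty by auto
  have "e \<in> set qs"
  proof (rule ccontr)
    assume "e \<notin> set qs"
    then have "is_path ?H ps qs" using path(1) by (auto simp: is_path_def)
    then have "(hd ps, last ps) \<in> (adj ?H)\<^sup>*"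
      using path_imp_reach[of ?H ps qs "length ps - 1"] nonempty by (simp add: last_conv_nth)
    then show False using no_reach path by blast
  qed
  moreover have "set vs1 \<inter> set vs2 = {}" using no_reach by blast
  ultimately show ?thesis
    using c1 c2 path m1 m2 unfolding circuit_path_edge_def loose_handcuff_def by blast
qed

subsection \<open>Deletion and contraction\<close>

lemma sum_Pow_insert:
  assumes "finite S" "x \<notin> S"
  shows "(\<Sum>A\<in>Pow (insert x S). f A) = (\<Sum>A\<in>Pow S. f A) + (\<Sum>A\<in>Pow S. f (insert x A))"
proof -
  have "inj_on (insert x) (Pow S)" using assms(2) by (auto simp: inj_on_def)
  moreover have "Pow S \<inter> insert x ` Pow S = {}" using assms(2) by auto
  ultimately show ?thesis
    using assms(1) by (simp add: Pow_insert sum.union_disjoint sum.reindex)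
qed

text \<open>Naming the summand lets the recursions be proved subset by subset.\<close>

definition tutte_term :: "('v, 'e) sgraph \<Rightarrow> 'a::comm_ring_1 \<Rightarrow> 'a \<Rightarrow> 'a \<Rightarrow> 'e set \<Rightarrow> 'a" where
  "tutte_term G X Y Z A =
     (X - 1) ^ (num_comp (spanning G A) - num_comp G) *
     (Y - 1) ^ (card A + num_bal (spanning G A) - card (verts G)) *
     (Z - 1) ^ num_unbal (spanning G A)"

lemma signed_tutte_eq: "signed_tutte G X Y Z = (\<Sum>A\<in>Pow (edges G). tutte_term G X Y Z A)"
  by (simp add: signed_tutte_def tutte_term_def)

lemma signed_tutte_split:
  assumes "signed_graph G" "e \<in> edges G"
  shows "signed_tutte G X Y Z =
    (\<Sum>A\<in>Pow (edges G - {e}). tutte_term G X Y Z A) +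
    (\<Sum>A\<in>Pow (edges G - {e}). tutte_term G X Y Z (insert e A))"
proof -
  have "edges G = insert e (edges G - {e})" using assms by auto
  then have "signed_tutte G X Y Z = (\<Sum>A\<in>Pow (insert e (edges G - {e})). tutte_term G X Y Z A)"
    unfolding signed_tutte_eq by (rule arg_cong)
  also have "finite (edges G - {e})" using assms by (simp add: signed_graph_def)
  then have "(\<Sum>A\<in>Pow (insert e (edges G - {e})). tutte_term G X Y Z A) =
    (\<Sum>A\<in>Pow (edges G - {e}). tutte_term G X Y Z A) +
    (\<Sum>A\<in>Pow (edges G - {e}). tutte_term G X Y Z (insert e A))"
    by (rule sum_Pow_insert) simp
  finally show ?thesis .
qed

text \<open>Going from \<open>insert e A\<close> to \<open>A\<close> in the contraction lowers the
  number of edges and the number of vertices by one each, so the exponent of \<open>Y - 1\<close> is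
  unchanged; all component counts are preserved.\<close>

lemma sum_with_edge_eq_contract:
  assumes sg: "signed_graph G" and e: "e \<in> edges G" "\<not> is_loop G e" "sign G e = 1"
  shows "(\<Sum>A\<in>Pow (edges G - {e}). tutte_term G X Y Z (insert e A)) =
    signed_tutte (contract G e) X Y Z"
  unfolding signed_tutte_eq contract_sel
proof (rule sum.cong[OF refl])
  fix A assume A: "A \<in> Pow (edges G - {e})"
  let ?S = "spanning G (insert e A)"
  obtain u v where uv: "ends G e = {u, v}" using signed_graph_ends[OF sg e(1)] .
  then have ne: "u \<noteq> v" using e by (auto simp: is_loop_def)
  have S: "signed_graph ?S" using A e by (intro signed_graph_spanning[OF sg]) auto
  have eS: "e \<in> edges ?S" "ends ?S e = {u, v}" "sign ?S e = 1" using uv e by auto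
  have con: "spanning (contract G e) A = contract ?S e"
    using A by (intro spanning_contract) auto
  have "finite A" using A sg by (auto simp: signed_graph_def intro: finite_subset)
  then have "card (insert e A) = Suc (card A)" using A by (subst card_insert_disjoint) auto
  moreover have "card (verts G) = Suc (card (verts (contract G e)))"
    using card_verts_contract[OF sg e(1) uv refl ne] .
  moreover have "num_comp (contract G e) = num_comp G"
    using num_comp_contract[OF sg e(1) uv refl] .
  ultimately show "tutte_term G X Y Z (insert e A) = tutte_term (contract G e) X Y Z A"
    unfolding tutte_term_def con
    using num_comp_contract[OF S eS(1,2) refl] num_bal_contract[OF S eS(1,2) refl eS(3)]
      num_unbal_contract[OF S eS(1,2) refl eS(3)] by simp
qed

text \<open>Both terms refer to the same spanning subgraph; only the normalisation by
  \<open>num_comp\<close> of the whole graph could differ, and an edge that is no bridge leaves it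
  unchanged.\<close>

lemma tutte_term_ordinary:
  assumes "signed_graph G" "is_ordinary G e"
  shows "tutte_term G X Y Z A = tutte_term (delete G e) X Y Z A"
proof -
  have e: "e \<in> edges G" using assms by (simp add: is_ordinary_def)
  obtain u v where uv: "ends G e = {u, v}" using signed_graph_ends[OF assms(1) e] .
  have "comp_of (delete G e) u = comp_of (delete G e) v"
    using assms bridge_iff[OF assms(1) e uv refl] by (auto simp: is_ordinary_def)
  then have "num_comp (delete G e) = num_comp G"
    using num_comp_same[OF assms(1) e uv refl] by blast
  then show ?thesis by (simp add: tutte_term_def)
qed

lemma num_comp_delete_bridge:
  assumes "signed_graph G" "is_bridge G e"
  shows "num_comp (delete G e) = Suc (num_comp G)"
proof -
  have e: "e \<in> edges G" using assms by (simp add: is_bridge_def)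
  obtain u v where uv: "ends G e = {u, v}" using signed_graph_ends[OF assms(1) e] .
  show ?thesis
    using num_comp_bridge[OF assms(1) e uv refl] bridge_iff[OF assms(1) e uv refl] assms(2) by blast
qed

text \<open>Only the normalisation changes: deleting the bridge adds one component. The bound from
  \<open>num_comp_spanning\<close> ensures that truncated subtraction does not swallow the resulting
  factor.\<close>

lemma tutte_term_bridge:
  assumes sg: "signed_graph G" and br: "is_bridge G e" and A: "A \<subseteq> edges G - {e}"
  shows "tutte_term G X Y Z A = (X - 1) * tutte_term (delete G e) X Y Z A"
proof -
  have "num_comp (delete G e) \<le> num_comp (spanning G A)"
    using num_comp_spanning[OF signed_graph_delete[OF sg, of e], of A] A by simp
  then have "num_comp (spanning G A) - num_comp G =
      Suc (num_comp (spanning G A) - num_comp (delete G e))"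
    using num_comp_delete_bridge[OF sg br] by linarith
  then show ?thesis by (simp add: tutte_term_def mult.assoc)
qed

text \<open>Adding \<open>e\<close> to \<open>A\<close> fuses two components, at least one of them
  balanced, so exactly one balanced component and no unbalanced one is lost. The extra edge
  compensates for this in the exponent of \<open>Y - 1\<close>, and the extra component of
  \<open>delete G e\<close> does so in that of \<open>X - 1\<close>.\<close>

lemma tutte_term_bridge_not_circuit_path:
  assumes sg: "signed_graph G" and br: "is_bridge G e" and A: "A \<subseteq> edges G - {e}"
    and nc: "\<not> circuit_path_edge G e"
  shows "tutte_term (delete G e) X Y Z A = tutte_term G X Y Z (insert e A)"
proof -
  let ?S = "spanning G (insert e A)" and ?T = "spanning G A"
  have e: "e \<in> edges G" using br by (simp add: is_bridge_def)
  obtain u v where uv: "ends G e = {u, v}" using signed_graph_ends[OF sg e] .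
  have S: "signed_graph ?S" using A e by (intro signed_graph_spanning[OF sg]) auto
  have T: "signed_graph ?T" using signed_graph_spanning[OF sg] A by auto
  have eS: "e \<in> edges ?S" "ends ?S e = {u, v}" using uv by auto
  have TS: "?T = delete ?S e" using A by (auto simp: delete_spanning intro: arg_cong)
  have V: "v \<in> verts G" using ends_in_verts[OF sg e uv refl] by blast
  have "comp_of (delete G e) u \<noteq> comp_of (delete G e) v"
    using bridge_iff[OF sg e uv refl] br by blast
  then have "(u, v) \<notin> (adj (delete G e))\<^sup>*" using comp_of_cong by metis
  moreover have "(adj ?T)\<^sup>* \<subseteq> (adj (delete G e))\<^sup>*"
    using A by (intro rtrancl_mono) (auto simp: adj_def)
  ultimately have ne: "comp_of ?T u \<noteq> comp_of ?T v"
    using comp_of_eq_iff[of v ?T u] V by auto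
  have "balanced_component ?T (comp_of ?T u) \<or> balanced_component ?T (comp_of ?T v)"
    using unbalanced_ends_imp_circuit_path_edge[OF sg e uv br A] nc by blast
  then have nb: "num_bal ?T = Suc (num_bal ?S)"
    using num_bal_bridge[OF S eS TS ne] by simp
  have ncT: "num_comp ?T = Suc (num_comp ?S)"
    using num_comp_bridge[OF S eS TS ne] .
  have nu: "num_unbal ?T = num_unbal ?S"
    using nb ncT num_comp_split[OF S] num_comp_split[OF T] by simp
  have "finite A" using A sg by (auto simp: signed_graph_def intro: finite_subset)
  then have "card (insert e A) = Suc (card A)" using A by (subst card_insert_disjoint) auto
  then show ?thesis
    using nb ncT nu num_comp_delete_bridge[OF sg br] by (simp add: tutte_term_def)
qed

lemma tutte_term_positive_loop:
  assumes sg: "signed_graph G" and lp: "is_loop G e" and s: "sign G e = 1"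
    and A: "A \<subseteq> edges G - {e}"
  shows "tutte_term G X Y Z A = tutte_term (delete G e) X Y Z A"
    and "tutte_term G X Y Z (insert e A) = (Y - 1) * tutte_term (delete G e) X Y Z A"
proof -
  let ?S = "spanning G (insert e A)" and ?T = "spanning G A"
  obtain u where e: "e \<in> edges G" and u: "ends G e = {u, u}" using lp by (auto simp: is_loop_def)
  have S: "signed_graph ?S" using A e by (intro signed_graph_spanning[OF sg]) auto
  have T: "signed_graph ?T" using signed_graph_spanning[OF sg] A by auto
  have eS: "e \<in> edges ?S" "ends ?S e = {u, u}" "sign ?S e = 1" using u s by auto
  have TS: "?T = delete ?S e" using A by (auto simp: delete_spanning intro: arg_cong)
  have nc: "num_comp ?T = num_comp ?S" using num_comp_same[OF S eS(1,2) TS refl] .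
  have nb: "num_bal ?T = num_bal ?S" using num_bal_positive_loop[OF S eS(1,2) TS refl eS(3)] .
  have nu: "num_unbal ?T = num_unbal ?S"
    using nb nc num_comp_split[OF S] num_comp_split[OF T] by simp
  have ncG: "num_comp (delete G e) = num_comp G" using num_comp_same[OF sg e u refl refl] .
  show "tutte_term G X Y Z A = tutte_term (delete G e) X Y Z A"
    using ncG by (simp add: tutte_term_def)
  have "finite A" using A sg by (auto simp: signed_graph_def intro: finite_subset)
  then have card: "card (insert e A) = Suc (card A)" using A by (subst card_insert_disjoint) auto
  \<comment> \<open>The rank bound allows the successor to be moved out of the truncated
    subtraction.\<close>
  have "card (verts G) \<le> card A + num_bal ?T" using card_verts_le[OF T] by simp
  then have "card (insert e A) + num_bal ?S - card (verts G) =
      Suc (card A + num_bal ?T - card (verts G))" using card nb by simp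
  then show "tutte_term G X Y Z (insert e A) = (Y - 1) * tutte_term (delete G e) X Y Z A"
    using nc nu ncG by (simp add: tutte_term_def mult_ac)
qed

subsection \<open>Single vertex\<close>

lemma single_vertex_components:
  assumes "verts G = {w}"
  shows "components G = {{w}}"
  using assms by (auto simp: components_eq comp_of_def)

lemma tutte_term_single_vertex_empty:
  assumes "verts G = {w}"
  shows "tutte_term G X Y Z {} = 1"
  using assms single_vertex_components[OF assms] single_vertex_components[of "spanning G {}"]
  by (simp add: tutte_term_def num_comp_def num_bal_def num_unbal_def balanced_no_edges
      Collect_conv_if)

text \<open>A single negative loop is an unbalanced cycle, so the only component is unbalanced and
  the exponent of \<open>Y - 1\<close> is \<open>card A + 0 - 1\<close>.\<close>

lemma tutte_term_negative_loops:
  assumes "verts G = {w}" and loops: "\<forall>f\<in>edges G. is_loop G f \<and> sign G f = -1"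
    and "signed_graph G" "A \<subseteq> edges G" "A \<noteq> {}"
  shows "tutte_term G X Y Z A = (Z - 1) * (Y - 1) ^ (card A - 1)"
proof -
  let ?S = "spanning G A"
  obtain f where f: "f \<in> A" using assms by blast
  then have "is_loop G f" "sign G f = -1" using assms by auto
  then obtain x where x: "ends G f = {x}" by (auto simp: is_loop_def)
  moreover obtain a where "a \<in> verts G" "a \<in> ends G f"
    using signed_graph_ends[OF assms(3), of f] f assms(4) by (metis insertI1 subsetD)
  ultimately have "x = w" using assms(1) by simp
  then have "is_cycle ?S [w] [f]" using f x assms by (simp add: is_cycle_def)
  moreover have "sign_product ?S [f] \<noteq> 1" using \<open>sign G f = -1\<close> by (simp add: sign_product_def)
  ultimately have "\<not> balanced_component ?S {w}"
    unfolding balanced_component_def balanced_cycle_def by force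
  then show ?thesis
    using assms(1) single_vertex_components[OF assms(1)] single_vertex_components[of ?S w]
    by (simp add: tutte_term_def num_comp_def num_bal_def num_unbal_def Collect_conv_if)
qed

text \<open>The binomial expansion of \<open>((Y - 1) + 1) ^ card S\<close>, indexed by
  subsets.\<close>

lemma sum_Pow_power:
  fixes Y :: "'a::comm_ring_1"
  assumes "finite S"
  shows "(\<Sum>A\<in>Pow S. (Y - 1) ^ card A) = Y ^ card S"
  using assms
proof (induction rule: finite_induct)
  case (insert x S)
  have "(\<Sum>A\<in>Pow S. (Y - 1) ^ card (insert x A)) = (\<Sum>A\<in>Pow S. (Y - 1) * (Y - 1) ^ card A)"
  proof (rule sum.cong[OF refl])
    fix A assume "A \<in> Pow S"
    then have "finite A" "x \<notin> A" using insert.hyps finite_subset by auto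
    then show "(Y - 1) ^ card (insert x A) = (Y - 1) * (Y - 1) ^ card A" by simp
  qed
  also have "\<dots> = (Y - 1) * Y ^ card S" by (simp add: sum_distrib_left[symmetric] insert.IH)
  finally show ?case
    using insert by (simp add: sum_Pow_insert algebra_simps)
qed simp

text \<open>The subsets containing the new element contribute \<open>Y ^ card S\<close>, the next
  term of the geometric sum. The induction avoids dividing by \<open>Y - 1\<close>, which an
  arbitrary ring does not permit.\<close>

lemma sum_nonempty_subsets_power:
  fixes Y :: "'a::comm_ring_1"
  assumes "finite S"
  shows "(\<Sum>A\<in>Pow S - {{}}. (Y - 1) ^ (card A - 1)) = (\<Sum>i<card S. Y ^ i)"
  using assms
proof (induction rule: finite_induct)
  case (insert x S)
  have "Pow (insert x S) - {{}} = (Pow S - {{}}) \<union> insert x ` Pow S"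
    by (auto simp: Pow_insert)
  moreover have "(Pow S - {{}}) \<inter> insert x ` Pow S = {}" using insert.hyps by auto
  moreover have "inj_on (insert x) (Pow S)" using insert.hyps by (auto simp: inj_on_def)
  ultimately have "(\<Sum>A\<in>Pow (insert x S) - {{}}. (Y - 1) ^ (card A - 1)) =
      (\<Sum>A\<in>Pow S - {{}}. (Y - 1) ^ (card A - 1)) +
      (\<Sum>A\<in>Pow S. (Y - 1) ^ (card (insert x A) - 1))"
    using insert.hyps by (simp add: sum.union_disjoint sum.reindex)
  also have "(\<Sum>A\<in>Pow S. (Y - 1) ^ (card (insert x A) - 1)) = (\<Sum>A\<in>Pow S. (Y - 1) ^ card A)"
  proof (rule sum.cong[OF refl])
    fix A assume "A \<in> Pow S"
    then have "finite A" "x \<notin> A" using insert.hyps finite_subset by auto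
    then show "(Y - 1) ^ (card (insert x A) - 1) = (Y - 1) ^ card A" by simp
  qed
  finally show ?case using insert sum_Pow_power by simp
qed simp

lemma signed_tutte_negative_loops:
  fixes X Y Z :: "'a::comm_ring_1"
  assumes "verts G = {w}" "\<forall>f\<in>edges G. is_loop G f \<and> sign G f = -1" "signed_graph G"
  shows "signed_tutte G X Y Z = 1 + (Z - 1) * (\<Sum>i<card (edges G). Y ^ i)"
proof -
  have fin: "finite (edges G)" using assms(3) by (simp add: signed_graph_def)
  have "signed_tutte G X Y Z =
      tutte_term G X Y Z {} + (\<Sum>A\<in>Pow (edges G) - {{}}. tutte_term G X Y Z A)"
    unfolding signed_tutte_eq using fin by (intro sum.remove) auto
  also have "(\<Sum>A\<in>Pow (edges G) - {{}}. tutte_term G X Y Z A) =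
      (\<Sum>A\<in>Pow (edges G) - {{}}. (Z - 1) * (Y - 1) ^ (card A - 1))"
    by (rule sum.cong[OF refl]) (use tutte_term_negative_loops[OF assms] in auto)
  also have "\<dots> = (Z - 1) * (\<Sum>i<card (edges G). Y ^ i)"
    by (simp only: sum_distrib_left[symmetric] sum_nonempty_subsets_power[OF fin])
  finally show ?thesis using tutte_term_single_vertex_empty[OF assms(1)] by simp
qed

section \<open>Assembling the reductions and the single-vertex values\<close>

theorem theorem4p1:
  fixes G :: "('v, 'e) sgraph" and X Y Z :: "'a::comm_ring_1"
  assumes "signed_graph G"
  shows
    "(\<forall>e\<in>edges G. sign G e = 1 \<longrightarrow>
        (is_ordinary G e \<longrightarrow>
           signed_tutte G X Y Z =
             signed_tutte (contract G e) X Y Z + signed_tutte (delete G e) X Y Z) \<and>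
        (is_bridge G e \<and> circuit_path_edge G e \<longrightarrow>
           signed_tutte G X Y Z =
             signed_tutte (contract G e) X Y Z + (X - 1) * signed_tutte (delete G e) X Y Z) \<and>
        (is_bridge G e \<and> \<not> circuit_path_edge G e \<longrightarrow>
           signed_tutte G X Y Z = X * signed_tutte (contract G e) X Y Z) \<and>
        (is_loop G e \<longrightarrow>
           signed_tutte G X Y Z = Y * signed_tutte (delete G e) X Y Z)) \<and>
     (\<forall>l\<ge>1. card (verts G) = 1 \<and> card (edges G) = l \<and>
        (\<forall>f\<in>edges G. is_loop G f \<and> sign G f = -1) \<longrightarrow>
        signed_tutte G X Y Z = 1 + (Z - 1) * (\<Sum>i<l. Y ^ i)) \<and>
     (card (verts G) = 1 \<and> edges G = {} \<longrightarrow> signed_tutte G X Y Z = 1)"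
proof (intro conjI ballI impI allI; (elim conjE)?)
  fix e assume e: "e \<in> edges G" and s: "sign G e = 1"
  let ?T = "\<lambda>H. signed_tutte H X Y Z"
  have split: "?T G = (\<Sum>A\<in>Pow (edges G - {e}). tutte_term G X Y Z A) +
      (\<Sum>A\<in>Pow (edges G - {e}). tutte_term G X Y Z (insert e A))"
    by (rule signed_tutte_split[OF assms e])
  have del: "?T (delete G e) = (\<Sum>A\<in>Pow (edges G - {e}). tutte_term (delete G e) X Y Z A)"
    by (simp add: signed_tutte_eq)
  {
    assume ord: "is_ordinary G e"
    then have "\<not> is_loop G e" by (simp add: is_ordinary_def)
    then show "?T G = signed_tutte (contract G e) X Y Z + ?T (delete G e)"
      unfolding split del sum_with_edge_eq_contract[OF assms e \<open>\<not> is_loop G e\<close> s]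
      by (simp add: tutte_term_ordinary[OF assms ord])
  }
  \<comment> \<open>Shared by both bridge cases: (ii) is this identity, and (iii) combines it with
    the equality of the polynomials of the deletion and the contraction, as
    \<open>1 + (X - 1) = X\<close>.\<close>
  have bridge: "?T G = signed_tutte (contract G e) X Y Z + (X - 1) * ?T (delete G e)"
    if br: "is_bridge G e"
  proof -
    have "\<not> is_loop G e" using br by (simp add: is_bridge_def)
    then show ?thesis
      unfolding split del sum_distrib_left
      using sum_with_edge_eq_contract[OF assms e _ s]
      by (simp add: tutte_term_bridge[OF assms br])
  qed
  {
    assume "is_bridge G e"
    then show "?T G = signed_tutte (contract G e) X Y Z + (X - 1) * ?T (delete G e)"
      by (rule bridge)
  }
  {
    assume br: "is_bridge G e" and nc: "\<not> circuit_path_edge G e"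
    then have "\<not> is_loop G e" by (simp add: is_bridge_def)
    have "?T (delete G e) = (\<Sum>A\<in>Pow (edges G - {e}). tutte_term G X Y Z (insert e A))"
      unfolding del
      by (rule sum.cong[OF refl]) (use tutte_term_bridge_not_circuit_path[OF assms br _ nc] in auto)
    also have "\<dots> = signed_tutte (contract G e) X Y Z"
      by (rule sum_with_edge_eq_contract[OF assms e \<open>\<not> is_loop G e\<close> s])
    finally show "?T G = X * signed_tutte (contract G e) X Y Z"
      using bridge[OF br] by (simp add: algebra_simps)
  }
  {
    assume lp: "is_loop G e"
    have "?T G = (\<Sum>A\<in>Pow (edges G - {e}). tutte_term (delete G e) X Y Z A) +
        (\<Sum>A\<in>Pow (edges G - {e}). (Y - 1) * tutte_term (delete G e) X Y Z A)"
      unfolding split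
      by (intro arg_cong2[where f = "(+)"] sum.cong refl)
        (use tutte_term_positive_loop[OF assms lp s] in auto)
    also have "\<dots> = ?T (delete G e) + (Y - 1) * ?T (delete G e)"
      by (simp only: del sum_distrib_left)
    finally show "?T G = Y * ?T (delete G e)"
      by (simp add: algebra_simps)
  }
next
  fix l assume "card (verts G) = 1" "card (edges G) = l"
    and "\<forall>f\<in>edges G. is_loop G f \<and> sign G f = -1"
  then show "signed_tutte G X Y Z = 1 + (Z - 1) * (\<Sum>i<l. Y ^ i)"
    using signed_tutte_negative_loops assms by (metis card_1_singletonE)
next
  assume "card (verts G) = 1" "edges G = {}"
  then show "signed_tutte G X Y Z = 1"
    using tutte_term_single_vertex_empty
    by (elim card_1_singletonE) (simp add: signed_tutte_eq)
qed

end
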